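(* Let $\Sigma_1=(X_1,X_{1,0},S_1,U,\to_1,Y,h_1)$ and $\Sigma_2=(X_2,X_{2,0},S_2,U,\to_2,Y,h_2)$ be NTSs with common input set $U$ and output set $Y$. If there exists an InfSOP bisimulation relation $\sim\subseteq X_1\times X_2$ between $\Sigma_1$ and $\Sigma_2$, then $\Sigma_1$ is infinite-step opaque if and only if $\Sigma_2$ is infinite-step opaque.
   Context: A nondeterministic transition system (NTS) is a tuple $\Sigma=(X,X_0,S,U,\to,Y,h)$, where $X$ is a (possibly infinite) set of states, $X_0\subseteq X$ the initial states, $S\subseteq X$ the secret states, $U$ a (possibly infinite) set of inputs, $\to\subseteq X\times U\times X$ the transition relation (write $x\xrightarrow{u}x'$ for $(x,u,x')\in\to$), $Y$ a set of outputs and $h:X\to Y$ the output map. $U^*$ is the set of finite sequences $\alpha=\alpha(0)\cdots\alpha(|\alpha|-1)$ over $U$, including the empty one. For $\alpha\in U^*$, a run over $\alpha$ is a nonempty sequence of states $x_0x_1\dots x_k$ with $k\le|\alpha|$, $x_0\in X_0$ and $(x_j,\alpha(j),x_{j+1})\in\to$ for all $j\in\{0,\dots,k-1\}$; it is maximal if $k=|\alpha|$ or there is no $x'$ with $(x_k,\alpha(k),x')\in\to$. $\Sigma$ is infinite-step opaque if for every $\alpha\in U^*$, every maximal run $x_0\dots x_k$ over $\alpha$ and every $i\in\{0,\dots,k\}$ with $x_i\in S$, there is a maximal run $x_0'\dots x_k'$ over $\alpha$ with $x_i'\notin S$ and $h(x_j)=h(x_j')$ for all $j\in\{0,\dots,k\}$.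 A relation $\sim\subseteq X_1\times X_2$ is an InfSOP (infinite-step opacity-preserving) bisimulation relation between $\Sigma_1$ and $\Sigma_2$ if: (1a) for every $x_{1,0}\in X_{1,0}\cap S_1$ there is $x_{2,0}\in X_{2,0}\cap S_2$ with $(x_{1,0},x_{2,0})\in\sim$; (1b) for every $x_{1,0}\in X_{1,0}\setminus S_1$ there is $x_{2,0}\in X_{2,0}\setminus S_2$ with $(x_{1,0},x_{2,0})\in\sim$; (1c) for every $x_{2,0}\in X_{2,0}\cap S_2$ there is $x_{1,0}\in X_{1,0}\cap S_1$ with $(x_{1,0},x_{2,0})\in\sim$; (1d) for every $x_{2,0}\in X_{2,0}\setminus S_2$ there is $x_{1,0}\in X_{1,0}\setminus S_1$ with $(x_{1,0},x_{2,0})\in\sim$; (2) $h_1(x_1)=h_2(x_2)$ for all $(x_1,x_2)\in\sim$; (3) for every $(x_1,x_2)\in\sim$ and every $u\in U$: (a) for every transition $x_1\xrightarrow{u}_1x_1'$ with $x_1'\in S_1$ there is a transition $x_2\xrightarrow{u}_2x_2'$ with $x_2'\in S_2$ and $(x_1',x_2')\in\sim$; (b) for every $x_1\xrightarrow{u}_1x_1'$ with $x_1'\in X_1\setminus S_1$ there is $x_2\xrightarrow{u}_2x_2'$ with $x_2'\in X_2\setminus S_2$ and $(x_1',x_2')\in\sim$; (c) for every $x_2\xrightarrow{u}_2x_2'$ with $x_2'\in S_2$ there is $x_1\xrightarrow{u}_1x_1'$ with $x_1'\in S_1$ and $(x_1',x_2')\in\sim$; (d) for every $x_2\xrightarrow{u}_2x_2'$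 with $x_2'\in X_2\setminus S_2$ there is $x_1\xrightarrow{u}_1x_1'$ with $x_1'\in X_1\setminus S_1$ and $(x_1',x_2')\in\sim$. *)

theory Defs
  imports Main
begin

record ('x, 'u, 'y) nts =
  states  :: "'x set"
  init    :: "'x set"
  secret  :: "'x set"
  inputs  :: "'u set"
  trans   :: "('x \<times> 'u \<times> 'x) set"
  outputs :: "'y set"
  outmap  :: "'x \<Rightarrow> 'y"

text \<open>The output map is a total HOL function; only its values on the states are meaningful.\<close>

definition is_nts :: "('x, 'u, 'y) nts \<Rightarrow> bool" where
  "is_nts \<Sigma> \<longleftrightarrow>
     init \<Sigma> \<subseteq> states \<Sigma> \<and>
     secret \<Sigma> \<subseteq> states \<Sigma> \<and>
     trans \<Sigma> \<subseteq> states \<Sigma> \<times> inputs \<Sigma> \<times> states \<Sigma> \<and>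
     outmap \<Sigma> ` states \<Sigma> \<subseteq> outputs \<Sigma>"

text \<open>A run $x_0 \dots x_k$ is the list of its $k + 1$ states.\<close>

definition run_over :: "('x, 'u, 'y) nts \<Rightarrow> 'u list \<Rightarrow> nat \<Rightarrow> 'x list \<Rightarrow> bool" where
  "run_over \<Sigma> \<alpha> k xs \<longleftrightarrow>
     length xs = k + 1 \<and> set xs \<subseteq> states \<Sigma> \<and> k \<le> length \<alpha> \<and>
     xs ! 0 \<in> init \<Sigma> \<and>
     (\<forall>j<k. (xs ! j, \<alpha> ! j, xs ! (j + 1)) \<in> trans \<Sigma>)"

definition maximal_run_over :: "('x, 'u, 'y) nts \<Rightarrow> 'u list \<Rightarrow> nat \<Rightarrow> 'x list \<Rightarrow> bool" where
  "maximal_run_over \<Sigma> \<alpha> k xs \<longleftrightarrow>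
     run_over \<Sigma> \<alpha> k xs \<and>
     (k = length \<alpha> \<or> \<not> (\<exists>x'. (xs ! k, \<alpha> ! k, x') \<in> trans \<Sigma>))"

definition infinite_step_opaque :: "('x, 'u, 'y) nts \<Rightarrow> bool" where
  "infinite_step_opaque \<Sigma> \<longleftrightarrow>
     (\<forall>\<alpha> \<in> lists (inputs \<Sigma>). \<forall>k xs. maximal_run_over \<Sigma> \<alpha> k xs \<longrightarrow>
       (\<forall>i\<le>k. xs ! i \<in> secret \<Sigma> \<longrightarrow>
         (\<exists>xs'. maximal_run_over \<Sigma> \<alpha> k xs' \<and> xs' ! i \<notin> secret \<Sigma> \<and>
           (\<forall>j\<le>k. outmap \<Sigma> (xs ! j) = outmap \<Sigma> (xs' ! j)))))"

text \<open>The inputs in the transfer conditions range over the inputs of the first system; the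
  notion is meant for two systems with the same inputs.\<close>

definition InfSOP_bisimulation ::
    "('x1, 'u, 'y) nts \<Rightarrow> ('x2, 'u, 'y) nts \<Rightarrow> ('x1 \<times> 'x2) set \<Rightarrow> bool" where
  "InfSOP_bisimulation \<Sigma>1 \<Sigma>2 R \<longleftrightarrow>
     R \<subseteq> states \<Sigma>1 \<times> states \<Sigma>2 \<and>
     (\<forall>x1 \<in> init \<Sigma>1 \<inter> secret \<Sigma>1. \<exists>x2 \<in> init \<Sigma>2 \<inter> secret \<Sigma>2. (x1, x2) \<in> R) \<and>
     (\<forall>x1 \<in> init \<Sigma>1 - secret \<Sigma>1. \<exists>x2 \<in> init \<Sigma>2 - secret \<Sigma>2. (x1, x2) \<in> R) \<and>
     (\<forall>x2 \<in> init \<Sigma>2 \<inter> secret \<Sigma>2. \<exists>x1 \<in> init \<Sigma>1 \<inter> secret \<Sigma>1. (x1, x2) \<in> R) \<and>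
     (\<forall>x2 \<in> init \<Sigma>2 - secret \<Sigma>2. \<exists>x1 \<in> init \<Sigma>1 - secret \<Sigma>1. (x1, x2) \<in> R) \<and>
     (\<forall>(x1, x2) \<in> R. outmap \<Sigma>1 x1 = outmap \<Sigma>2 x2) \<and>
     (\<forall>(x1, x2) \<in> R. \<forall>u \<in> inputs \<Sigma>1.
       (\<forall>x1' \<in> secret \<Sigma>1. (x1, u, x1') \<in> trans \<Sigma>1 \<longrightarrow>
         (\<exists>x2' \<in> secret \<Sigma>2. (x2, u, x2') \<in> trans \<Sigma>2 \<and> (x1', x2') \<in> R)) \<and>
       (\<forall>x1' \<in> states \<Sigma>1 - secret \<Sigma>1. (x1, u, x1') \<in> trans \<Sigma>1 \<longrightarrow>
         (\<exists>x2' \<in> states \<Sigma>2 - secret \<Sigma>2. (x2, u, x2') \<in> trans \<Sigma>2 \<and> (x1', x2') \<in> R)) \<and>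
       (\<forall>x2' \<in> secret \<Sigma>2. (x2, u, x2') \<in> trans \<Sigma>2 \<longrightarrow>
         (\<exists>x1' \<in> secret \<Sigma>1. (x1, u, x1') \<in> trans \<Sigma>1 \<and> (x1', x2') \<in> R)) \<and>
       (\<forall>x2' \<in> states \<Sigma>2 - secret \<Sigma>2. (x2, u, x2') \<in> trans \<Sigma>2 \<longrightarrow>
         (\<exists>x1' \<in> states \<Sigma>1 - secret \<Sigma>1. (x1, u, x1') \<in> trans \<Sigma>1 \<and> (x1', x2') \<in> R)))"

end

theory Submission
  imports Defs
begin

text \<open>
  Call the pair of the output and the secrecy status of a state its observation. Whether a system
  is infinite-step opaque depends only on the sequences of observations along its maximal runs.
  Cut down to the pairs of states with equal observations, an InfSOP bisimulation relation becomes
  an ordinary bisimulation for inputs as labels and observations as state colours. Such a relation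
  lifts maximal runs in both directions, so both systems have the same observation sequences.
\<close>

definition observation :: "('x, 'u, 'y) nts \<Rightarrow> 'x \<Rightarrow> 'y \<times> bool" where
  "observation \<Sigma> x = (outmap \<Sigma> x, x \<in> secret \<Sigma>)"

definition observed_runs :: "('x, 'u, 'y) nts \<Rightarrow> 'u list \<Rightarrow> nat \<Rightarrow> ('y \<times> bool) list set" where
  "observed_runs \<Sigma> \<alpha> k = map (observation \<Sigma>) ` {xs. maximal_run_over \<Sigma> \<alpha> k xs}"

lemma infinite_step_opaque_iff_observed_runs:
  "infinite_step_opaque \<Sigma> \<longleftrightarrow>
    (\<forall>\<alpha> \<in> lists (inputs \<Sigma>). \<forall>k. \<forall>w \<in> observed_runs \<Sigma> \<alpha> k. \<forall>i\<le>k. snd (w ! i) \<longrightarrow>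
      (\<exists>w' \<in> observed_runs \<Sigma> \<alpha> k. \<not> snd (w' ! i) \<and> (\<forall>j\<le>k. fst (w ! j) = fst (w' ! j))))"
proof -
  have observation_nth: "map (observation \<Sigma>) xs ! j = (outmap \<Sigma> (xs ! j), xs ! j \<in> secret \<Sigma>)"
    if "maximal_run_over \<Sigma> \<alpha> k xs" and "j \<le> k" for \<alpha> k xs j
    using that by (simp add: maximal_run_over_def run_over_def observation_def)
  show ?thesis
    unfolding infinite_step_opaque_def observed_runs_def
    by (simp add: observation_nth cong: conj_cong)
qed

lemma infinite_step_opaque_cong:
  assumes "inputs \<Sigma>1 = inputs \<Sigma>2"
    and "\<And>\<alpha> k. observed_runs \<Sigma>1 \<alpha> k = observed_runs \<Sigma>2 \<alpha> k"
  shows "infinite_step_opaque \<Sigma>1 \<longleftrightarrow> infinite_step_opaque \<Sigma>2"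
  by (simp add: infinite_step_opaque_iff_observed_runs assms)

lemma run_over_0:
  assumes "is_nts \<Sigma>"
  shows "run_over \<Sigma> \<alpha> 0 xs \<longleftrightarrow> (\<exists>x \<in> init \<Sigma>. xs = [x])"
  using assms by (auto simp: run_over_def is_nts_def length_Suc_conv)

lemma run_over_Suc:
  assumes "is_nts \<Sigma>"
  shows "run_over \<Sigma> \<alpha> (Suc k) xs \<longleftrightarrow>
    (\<exists>ys y. xs = ys @ [y] \<and> run_over \<Sigma> \<alpha> k ys \<and> k < length \<alpha> \<and> (ys ! k, \<alpha> ! k, y) \<in> trans \<Sigma>)"
proof (cases xs rule: rev_cases)
  case Nil
  then show ?thesis by (simp add: run_over_def)
next
  case (snoc ys y)
  have "y \<in> states \<Sigma>" if "(ys ! k, \<alpha> ! k, y) \<in> trans \<Sigma>"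
    using assms that by (auto simp: is_nts_def)
  then show ?thesis
    using snoc by (auto simp: run_over_def nth_append less_Suc_eq)
qed

definition same_observation ::
    "('x1, 'u, 'y) nts \<Rightarrow> ('x2, 'u, 'y) nts \<Rightarrow> ('x1 \<times> 'x2) set" where
  "same_observation \<Sigma>1 \<Sigma>2 = {(x1, x2). observation \<Sigma>1 x1 = observation \<Sigma>2 x2}"

definition simulation ::
    "('x1, 'u, 'y) nts \<Rightarrow> ('x2, 'u, 'y) nts \<Rightarrow> ('x1 \<times> 'x2) set \<Rightarrow> bool" where
  "simulation \<Sigma>1 \<Sigma>2 R \<longleftrightarrow>
     R \<subseteq> same_observation \<Sigma>1 \<Sigma>2 \<and>
     (\<forall>x1 \<in> init \<Sigma>1. \<exists>x2 \<in> init \<Sigma>2. (x1, x2) \<in> R) \<and>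
     (\<forall>(x1, x2) \<in> R. \<forall>u x1'. (x1, u, x1') \<in> trans \<Sigma>1 \<longrightarrow>
       (\<exists>x2'. (x2, u, x2') \<in> trans \<Sigma>2 \<and> (x1', x2') \<in> R))"

definition bisimulation ::
    "('x1, 'u, 'y) nts \<Rightarrow> ('x2, 'u, 'y) nts \<Rightarrow> ('x1 \<times> 'x2) set \<Rightarrow> bool" where
  "bisimulation \<Sigma>1 \<Sigma>2 R \<longleftrightarrow> simulation \<Sigma>1 \<Sigma>2 R \<and> simulation \<Sigma>2 \<Sigma>1 (R\<inverse>)"

lemma bisimulation_converse:
  "bisimulation \<Sigma>2 \<Sigma>1 (R\<inverse>) \<longleftrightarrow> bisimulation \<Sigma>1 \<Sigma>2 R"
  by (auto simp: bisimulation_def)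

lemma simulation_init:
  assumes "simulation \<Sigma>1 \<Sigma>2 R" and "x1 \<in> init \<Sigma>1"
  obtains x2 where "x2 \<in> init \<Sigma>2" and "(x1, x2) \<in> R"
  using assms unfolding simulation_def by blast

lemma simulation_step:
  assumes "simulation \<Sigma>1 \<Sigma>2 R" and "(x1, x2) \<in> R" and "(x1, u, x1') \<in> trans \<Sigma>1"
  obtains x2' where "(x2, u, x2') \<in> trans \<Sigma>2" and "(x1', x2') \<in> R"
  using assms unfolding simulation_def by blast

lemma simulation_map_observation:
  assumes "simulation \<Sigma>1 \<Sigma>2 R" and "list_all2 (\<lambda>x y. (x, y) \<in> R) xs ys"
  shows "map (observation \<Sigma>1) xs = map (observation \<Sigma>2) ys"
  using assms(2)
  by induction (use assms(1) in \<open>auto simp: simulation_def same_observation_def\<close>)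

lemma simulation_run:
  assumes sim: "simulation \<Sigma>1 \<Sigma>2 R" and nts: "is_nts \<Sigma>1" "is_nts \<Sigma>2"
    and run: "run_over \<Sigma>1 \<alpha> k xs"
  shows "\<exists>ys. run_over \<Sigma>2 \<alpha> k ys \<and> list_all2 (\<lambda>x y. (x, y) \<in> R) xs ys"
  using run
proof (induction k arbitrary: xs)
  case 0
  then obtain x where "x \<in> init \<Sigma>1" and xs: "xs = [x]"
    using run_over_0[OF nts(1)] by blast
  then obtain y where "y \<in> init \<Sigma>2" and "(x, y) \<in> R"
    using simulation_init[OF sim] by blast
  then show ?case
    using run_over_0[OF nts(2)] xs by blast
next
  case (Suc k)
  then obtain xs' x where xs: "xs = xs' @ [x]" and run: "run_over \<Sigma>1 \<alpha> k xs'"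
    and k: "k < length \<alpha>" and step: "(xs' ! k, \<alpha> ! k, x) \<in> trans \<Sigma>1"
    using run_over_Suc[OF nts(1)] by blast
  obtain ys where ys: "run_over \<Sigma>2 \<alpha> k ys" and rel: "list_all2 (\<lambda>x y. (x, y) \<in> R) xs' ys"
    using Suc.IH[OF run] by blast
  have "(xs' ! k, ys ! k) \<in> R"
    using list_all2_nthD[OF rel] run by (simp add: run_over_def)
  then obtain y where "(ys ! k, \<alpha> ! k, y) \<in> trans \<Sigma>2" and xy: "(x, y) \<in> R"
    using simulation_step[OF sim _ step] by blast
  then have "run_over \<Sigma>2 \<alpha> (Suc k) (ys @ [y])"
    using run_over_Suc[OF nts(2)] ys k by blast
  moreover have "list_all2 (\<lambda>x y. (x, y) \<in> R) xs (ys @ [y])"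
    using xs rel xy by (simp add: list_all2_appendI)
  ultimately show ?case by blast
qed

lemma bisimulation_maximal_run:
  assumes bisim: "bisimulation \<Sigma>1 \<Sigma>2 R" and nts: "is_nts \<Sigma>1" "is_nts \<Sigma>2"
    and max: "maximal_run_over \<Sigma>1 \<alpha> k xs"
  obtains ys where "maximal_run_over \<Sigma>2 \<alpha> k ys" and "list_all2 (\<lambda>x y. (x, y) \<in> R) xs ys"
proof -
  have sim: "simulation \<Sigma>1 \<Sigma>2 R" "simulation \<Sigma>2 \<Sigma>1 (R\<inverse>)"
    using bisim by (simp_all add: bisimulation_def)
  have run: "run_over \<Sigma>1 \<alpha> k xs"
    using max by (simp add: maximal_run_over_def)
  obtain ys where ys: "run_over \<Sigma>2 \<alpha> k ys" and rel: "list_all2 (\<lambda>x y. (x, y) \<in> R) xs ys"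
    using simulation_run[OF sim(1) nts run] by blast
  have "(ys ! k, xs ! k) \<in> R\<inverse>"
    using list_all2_nthD[OF rel] run by (simp add: run_over_def)
  then have "\<exists>x'. (xs ! k, \<alpha> ! k, x') \<in> trans \<Sigma>1" if "(ys ! k, \<alpha> ! k, y') \<in> trans \<Sigma>2" for y'
    using simulation_step[OF sim(2)] that by blast
  then have "maximal_run_over \<Sigma>2 \<alpha> k ys"
    using max ys unfolding maximal_run_over_def by blast
  then show thesis
    using rel that by blast
qed

lemma bisimulation_observed_runs_subset:
  assumes bisim: "bisimulation \<Sigma>1 \<Sigma>2 R" and nts: "is_nts \<Sigma>1" "is_nts \<Sigma>2"
  shows "observed_runs \<Sigma>1 \<alpha> k \<subseteq> observed_runs \<Sigma>2 \<alpha> k"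
proof
  fix w
  assume "w \<in> observed_runs \<Sigma>1 \<alpha> k"
  then obtain xs where xs: "maximal_run_over \<Sigma>1 \<alpha> k xs" and w: "w = map (observation \<Sigma>1) xs"
    by (auto simp: observed_runs_def)
  obtain ys where ys: "maximal_run_over \<Sigma>2 \<alpha> k ys"
    and rel: "list_all2 (\<lambda>x y. (x, y) \<in> R) xs ys"
    using bisimulation_maximal_run[OF bisim nts xs] by blast
  have "simulation \<Sigma>1 \<Sigma>2 R"
    using bisim by (simp add: bisimulation_def)
  then have "w = map (observation \<Sigma>2) ys"
    using simulation_map_observation rel w by blast
  then show "w \<in> observed_runs \<Sigma>2 \<alpha> k"
    using ys by (simp add: observed_runs_def)
qed

lemma bisimulation_observed_runs_eq:
  assumes "bisimulation \<Sigma>1 \<Sigma>2 R" and "is_nts \<Sigma>1" and "is_nts \<Sigma>2"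
  shows "observed_runs \<Sigma>1 \<alpha> k = observed_runs \<Sigma>2 \<alpha> k"
proof
  show "observed_runs \<Sigma>1 \<alpha> k \<subseteq> observed_runs \<Sigma>2 \<alpha> k"
    using assms by (rule bisimulation_observed_runs_subset)
  show "observed_runs \<Sigma>2 \<alpha> k \<subseteq> observed_runs \<Sigma>1 \<alpha> k"
    using assms bisimulation_observed_runs_subset bisimulation_converse by blast
qed

lemma InfSOP_bisimulation_converse:
  assumes "InfSOP_bisimulation \<Sigma>1 \<Sigma>2 R" and inputs: "inputs \<Sigma>1 = inputs \<Sigma>2"
  shows "InfSOP_bisimulation \<Sigma>2 \<Sigma>1 (R\<inverse>)"
proof -
  have "R\<inverse> \<subseteq> A \<times> B \<longleftrightarrow> R \<subseteq> B \<times> A" for A B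
    by auto
  moreover have "(\<forall>(y, x) \<in> R\<inverse>. P y x) \<longleftrightarrow> (\<forall>(x, y) \<in> R. P y x)" for P
    by auto
  moreover have "(\<forall>(x, y) \<in> R. outmap \<Sigma>2 y = outmap \<Sigma>1 x) \<longleftrightarrow>
      (\<forall>(x, y) \<in> R. outmap \<Sigma>1 x = outmap \<Sigma>2 y)"
    by (simp only: eq_commute)
  ultimately have "InfSOP_bisimulation \<Sigma>2 \<Sigma>1 (R\<inverse>) \<longleftrightarrow> InfSOP_bisimulation \<Sigma>1 \<Sigma>2 R"
    by (simp only: InfSOP_bisimulation_def inputs converse_iff conj_ac)
  then show ?thesis
    using assms(1) by blast
qed

lemma InfSOP_bisimulation_imp_simulation:
  assumes bisim: "InfSOP_bisimulation \<Sigma>1 \<Sigma>2 R" and nts: "is_nts \<Sigma>1"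
  shows "simulation \<Sigma>1 \<Sigma>2 (R \<inter> same_observation \<Sigma>1 \<Sigma>2)"
proof -
  have same_obs: "(x1, x2) \<in> same_observation \<Sigma>1 \<Sigma>2"
    if "(x1, x2) \<in> R" and "x1 \<in> secret \<Sigma>1 \<longleftrightarrow> x2 \<in> secret \<Sigma>2" for x1 x2
    using bisim that
    by (auto simp: InfSOP_bisimulation_def same_observation_def observation_def)
  have "\<exists>x2 \<in> init \<Sigma>2. (x1, x2) \<in> R \<inter> same_observation \<Sigma>1 \<Sigma>2" if "x1 \<in> init \<Sigma>1" for x1
  proof -
    have "\<exists>x2 \<in> init \<Sigma>2. (x1, x2) \<in> R \<and> (x1 \<in> secret \<Sigma>1 \<longleftrightarrow> x2 \<in> secret \<Sigma>2)"
      using bisim that unfolding InfSOP_bisimulation_def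
      by (cases "x1 \<in> secret \<Sigma>1") blast+
    then show ?thesis
      using same_obs by blast
  qed
  moreover have "\<exists>x2'. (x2, u, x2') \<in> trans \<Sigma>2 \<and> (x1', x2') \<in> R \<inter> same_observation \<Sigma>1 \<Sigma>2"
    if "(x1, x2) \<in> R" and "(x1, u, x1') \<in> trans \<Sigma>1" for x1 x2 u x1'
  proof -
    have "u \<in> inputs \<Sigma>1" and "x1' \<in> states \<Sigma>1"
      using nts that(2) by (auto simp: is_nts_def)
    then have "\<exists>x2'. (x2, u, x2') \<in> trans \<Sigma>2 \<and> (x1', x2') \<in> R \<and>
        (x1' \<in> secret \<Sigma>1 \<longleftrightarrow> x2' \<in> secret \<Sigma>2)"
      using bisim that unfolding InfSOP_bisimulation_def
      by (cases "x1' \<in> secret \<Sigma>1") blast+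
    then show ?thesis
      using same_obs by blast
  qed
  ultimately show ?thesis
    unfolding simulation_def by blast
qed

lemma InfSOP_bisimulation_imp_bisimulation:
  assumes bisim: "InfSOP_bisimulation \<Sigma>1 \<Sigma>2 R" and nts: "is_nts \<Sigma>1" "is_nts \<Sigma>2"
    and inputs: "inputs \<Sigma>1 = inputs \<Sigma>2"
  shows "bisimulation \<Sigma>1 \<Sigma>2 (R \<inter> same_observation \<Sigma>1 \<Sigma>2)"
proof -
  have "(R \<inter> same_observation \<Sigma>1 \<Sigma>2)\<inverse> = R\<inverse> \<inter> same_observation \<Sigma>2 \<Sigma>1"
    by (auto simp: same_observation_def)
  then show ?thesis
    using InfSOP_bisimulation_imp_simulation[OF bisim nts(1)]
      InfSOP_bisimulation_imp_simulation[OF InfSOP_bisimulation_converse[OF bisim inputs] nts(2)]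
    by (simp add: bisimulation_def)
qed

theorem theorem3p18:
  fixes \<Sigma>1 :: "('x1, 'u, 'y) nts" and \<Sigma>2 :: "('x2, 'u, 'y) nts"
  assumes "is_nts \<Sigma>1" and "is_nts \<Sigma>2"
    and "inputs \<Sigma>1 = inputs \<Sigma>2" and "outputs \<Sigma>1 = outputs \<Sigma>2"
    and "\<exists>R. InfSOP_bisimulation \<Sigma>1 \<Sigma>2 R"
  shows "infinite_step_opaque \<Sigma>1 \<longleftrightarrow> infinite_step_opaque \<Sigma>2"
proof -
  obtain R where "InfSOP_bisimulation \<Sigma>1 \<Sigma>2 R"
    using assms(5) by blast
  then have "bisimulation \<Sigma>1 \<Sigma>2 (R \<inter> same_observation \<Sigma>1 \<Sigma>2)"
    using assms(1-3) by (rule InfSOP_bisimulation_imp_bisimulation)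
  then have "observed_runs \<Sigma>1 \<alpha> k = observed_runs \<Sigma>2 \<alpha> k" for \<alpha> k
    using assms(1,2) by (rule bisimulation_observed_runs_eq)
  with assms(3) show ?thesis
    by (rule infinite_step_opaque_cong)
qed

end
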